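(* For every positive integer $n$, the number of elements of the spine of the slow Tamari lattice $\operatorname{sTam}_n$ is $\sum_{i+j=n+1,\ i,j\ge1}f_{i,j}$, where the numbers $f_{i,j}$, $i,j\ge1$, are defined by $f_{i,1}=f_{1,j}=1$ for $i,j\ge1$ and $$f_{i,j}=i\,f_{i,j-1}+j\,f_{i-1,j}-(i-1)(j-1)f_{i-1,j-1}\qquad\text{for } i,j>1.$$
   Context: Let $n$ be a positive integer. The board of size $n$ is the Ferrers diagram of shape $(n,n,n-1,n-2,\dots,3,2)$ (a single cell $(1,1)$ if $n=1$). Its cells are written $(i,j)$, where $i$ is the row, numbered from the top, and $j$ is the column label, the columns being labelled $n,n-1,\dots,1$ from left to right. So the cells are $(1,j)$ for $1\le j\le n$ and $(i,j)$ for $2\le i\le n$, $i-1\le j\le n$. The root is $(1,n)$ (top-left cell); the border cells are $(i,i-1)$ for $2\le i\le n$ (the rightmost cells of rows $2,\dots,n$). An fb-tableau of size $n$ is a filling in which each cell is either empty or nonempty such that the root and all border cells are nonempty, and every nonempty cell other than the root has a nonempty cell strictly to its left in the same row or strictly above it in the same column. In an fb-tableau, a nonempty cell different from the root is called a left-arrow if there is no nonempty cell strictly to its left in its row, an up-arrow if there is no nonempty cell strictly above it in its column, and a dot otherwise; the root is also a dot. (Each of rows $2,\dots,n$ has exactly one left-arrow, each of columns $1,\dots,n-1$ has exactly one up-arrow.) A cell is free in $T$ if it lies strictly below an up-arrow (same column) and strictly to the right of a left-arrow (same row); a free cell is either empty or contains a dot. $\operatorname{Row}(T)$ is the set of cells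 lying weakly to the right of a left-arrow or of the root in the same row; $\operatorname{Col}(T)$ is the set of cells lying weakly below an up-arrow or the root in the same column. For fb-tableaux $S,T$ of size $n$, write $S\lhd T$ if (1) $\operatorname{Col}(S)\subseteq\operatorname{Col}(T)$; (2) $\operatorname{Row}(T)\subseteq\operatorname{Row}(S)$; (3) for every cell $c$ that is free in both $S$ and $T$, if $c$ contains a dot in $S$ then $c$ contains a dot in $T$. An fb-tableau is small if its only dot is the root (equivalently, all its free cells are empty). The slow Tamari lattice $\operatorname{sTam}_n$ is the set of small fb-tableaux of size $n$ ordered by $\lhd$; it is a finite (trim) lattice. Its spine is the set of elements of $\operatorname{sTam}_n$ that belong to some chain of maximum length in $\operatorname{sTam}_n$. *)

theory Defs
  imports Main
begin

text \<open>
  A cell (i, j) has row index i, increasing downwards, and column label j. Column labels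
  decrease from left to right, so "to the left" means "larger column label".
\<close>

type_synonym cell = "nat \<times> nat"

text \<open>For rows i > 1 the condition i \<le> j + 1 is i - 1 \<le> j; for i = 1 it is vacuous.\<close>

definition board :: "nat \<Rightarrow> cell set" where
  "board n = {(i, j). 1 \<le> i \<and> i \<le> n \<and> 1 \<le> j \<and> j \<le> n \<and> i \<le> j + 1}"

definition root :: "nat \<Rightarrow> cell" where
  "root n = (1, n)"

definition border :: "nat \<Rightarrow> cell set" where
  "border n = {(i, i - 1) | i. 2 \<le> i \<and> i \<le> n}"

definition left_of :: "cell \<Rightarrow> cell \<Rightarrow> bool" where
  "left_of c d \<longleftrightarrow> fst c = fst d \<and> snd c > snd d"

definition above :: "cell \<Rightarrow> cell \<Rightarrow> bool" where
  "above c d \<longleftrightarrow> snd c = snd d \<and> fst c < fst d"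

text \<open>A filling of the board is represented by its set T of nonempty cells.\<close>

definition fb_tableau :: "nat \<Rightarrow> cell set \<Rightarrow> bool" where
  "fb_tableau n T \<longleftrightarrow> T \<subseteq> board n \<and> root n \<in> T \<and> border n \<subseteq> T \<and>
     (\<forall>c\<in>T. c \<noteq> root n \<longrightarrow> (\<exists>d\<in>T. left_of d c \<or> above d c))"

definition left_arrows :: "nat \<Rightarrow> cell set \<Rightarrow> cell set" where
  "left_arrows n T = {c \<in> T. c \<noteq> root n \<and> \<not> (\<exists>d\<in>T. left_of d c)}"

definition up_arrows :: "nat \<Rightarrow> cell set \<Rightarrow> cell set" where
  "up_arrows n T = {c \<in> T. c \<noteq> root n \<and> \<not> (\<exists>d\<in>T. above d c)}"

text \<open>The root is neither a left-arrow nor an up-arrow, hence a dot.\<close>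

definition dots :: "nat \<Rightarrow> cell set \<Rightarrow> cell set" where
  "dots n T = T - left_arrows n T - up_arrows n T"

definition free_cells :: "nat \<Rightarrow> cell set \<Rightarrow> cell set" where
  "free_cells n T = {c \<in> board n. (\<exists>u \<in> up_arrows n T. above u c) \<and>
                                  (\<exists>l \<in> left_arrows n T. left_of l c)}"

definition Row :: "nat \<Rightarrow> cell set \<Rightarrow> cell set" where
  "Row n T = {c \<in> board n. \<exists>l \<in> insert (root n) (left_arrows n T). l = c \<or> left_of l c}"

definition Col :: "nat \<Rightarrow> cell set \<Rightarrow> cell set" where
  "Col n T = {c \<in> board n. \<exists>u \<in> insert (root n) (up_arrows n T). u = c \<or> above u c}"

definition fb_le :: "nat \<Rightarrow> cell set \<Rightarrow> cell set \<Rightarrow> bool" where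
  "fb_le n S T \<longleftrightarrow> Col n S \<subseteq> Col n T \<and> Row n T \<subseteq> Row n S \<and>
     (\<forall>c \<in> free_cells n S \<inter> free_cells n T. c \<in> dots n S \<longrightarrow> c \<in> dots n T)"

text \<open>The carrier of the slow Tamari lattice, the order being the relation \<open>fb_le n\<close>.\<close>

definition sTam :: "nat \<Rightarrow> cell set set" where
  "sTam n = {T. fb_tableau n T \<and> dots n T = {root n}}"

definition sTam_chain :: "nat \<Rightarrow> cell set set \<Rightarrow> bool" where
  "sTam_chain n C \<longleftrightarrow> C \<subseteq> sTam n \<and> Complete_Partial_Order.chain (fb_le n) C"

text \<open>All chains are finite, since \<open>sTam n\<close> is; so length can be measured by \<open>card\<close>.\<close>

definition spine :: "nat \<Rightarrow> cell set set" where
  "spine n = {T. \<exists>C. sTam_chain n C \<and> (\<forall>D. sTam_chain n D \<longrightarrow> card D \<le> card C) \<and> T \<in> C}"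

text \<open>
  Only the values at positive indices are meaningful; the value 1 at index 0 is arbitrary.
\<close>

fun f :: "nat \<Rightarrow> nat \<Rightarrow> int" where
  "f i j = (if i \<le> 1 \<or> j \<le> 1 then 1
            else int i * f i (j - 1) + int j * f (i - 1) j
                 - (int i - 1) * (int j - 1) * f (i - 1) (j - 1))"

declare f.simps [simp del]

end

(* A small tableau is determined by a vector d in {0..n-1}^(n-1), and the order becomes the
   componentwise order on the admissible vectors. Hence a chain has at most (n-1)^2 + 1 elements, and
   in a chain of that length consecutive vectors differ by one in a single entry. Such steps
   from the zero vector can only reach vectors with "n <= d k + j implies n <= d j + k" for k < j.
   Conversely, raising the last non-maximal entry or lowering the first nonzero entry preserves
   this condition, so every such vector lies on a chain of maximum length. Splitting these vectors by
   the number m of border cells that are up-arrows gives pairs of disjoint families of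
   left-justified horizontal and top-justified vertical bars in an m x (n-1-m) rectangle, which
   satisfy the recurrence of f. *)
theory Submission
  imports Defs "HOL-Library.FuncSet"
begin

section \<open>Small tableaux as integer vectors\<close>

text \<open>A border cell is the last cell of its row and of its column, and in a small tableau it
  is exactly one of left-arrow and up-arrow. So of the left-arrow of row \<open>k + 1\<close> and
  the up-arrow of column \<open>k\<close> one rests on the border cell, while the other occupies one
  of the \<open>n\<close> remaining cells of the hook formed by that row and that column;
  \<open>d k\<close> numbers these cells, rightwards and then upwards. For \<open>k < j\<close> the
  hooks cross only in the cell \<open>(k + 1, j)\<close>. \<open>admissible\<close> is the support
  condition there: when the moving arrow of hook \<open>j\<close> stands on the crossing, the
  left-arrow of row \<open>k + 1\<close> must still be to its left; when that of hook
  \<open>k\<close> stands on it, the up-arrow of column \<open>j\<close> must already be above it. A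
  vector can nevertheless be admissible with hook \<open>k\<close> beyond the crossing and hook
  \<open>j\<close> short of it. \<open>spinal\<close> forbids this: hook \<open>j\<close> has to
  pass the crossing before hook \<open>k\<close> reaches it. In unit steps hook \<open>k\<close>
  cannot jump over the crossing, and hook \<open>j\<close> never moves back, which is why long
  chains obey \<open>spinal\<close>.\<close>

definition heights :: "nat \<Rightarrow> (nat \<Rightarrow> nat) set" where
  "heights n = {1..<n} \<rightarrow>\<^sub>E {..<n}"

text \<open>
  A tableau is encoded by \<open>d\<close>, where \<open>d k\<close> measures the progress along the hook that runs rightwards
  through row \<open>k + 1\<close> from column \<open>n\<close> and then upwards through column \<open>k\<close>. While \<open>d k < n - k\<close>, the
  border cell \<open>(k + 1, k)\<close> is an up-arrow and the left-arrow of row \<open>k + 1\<close> is \<open>(k + 1, n - d k)\<close>;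
  afterwards the border cell is a left-arrow and the up-arrow of column \<open>k\<close> is \<open>(n - d k, k)\<close>.
\<close>

definition leftmost :: "nat \<Rightarrow> (nat \<Rightarrow> nat) \<Rightarrow> nat \<Rightarrow> nat" where
  "leftmost n d k = max k (n - d k)"

definition topmost :: "nat \<Rightarrow> (nat \<Rightarrow> nat) \<Rightarrow> nat \<Rightarrow> nat" where
  "topmost n d k = min (k + 1) (n - d k)"

text \<open>The border cells are included implicitly: \<open>(k + 1, k)\<close> is the left-arrow
  given by \<open>k\<close> if \<open>n \<le> d k + k\<close>, and the up-arrow given by
  \<open>k\<close> otherwise.\<close>

definition tableau :: "nat \<Rightarrow> (nat \<Rightarrow> nat) \<Rightarrow> cell set" where
  "tableau n d = insert (root n)
     ((\<lambda>k. (k + 1, leftmost n d k)) ` {1..<n} \<union> (\<lambda>k. (topmost n d k, k)) ` {1..<n})"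

text \<open>Written additively to avoid truncated subtraction.\<close>

definition admissible :: "nat \<Rightarrow> (nat \<Rightarrow> nat) \<Rightarrow> bool" where
  "admissible n d \<longleftrightarrow> (\<forall>k j. 1 \<le> k \<longrightarrow> k < j \<longrightarrow> j < n \<longrightarrow>
     (d j + k + 1 = n \<longrightarrow> d k + j < n) \<and> (d k + j = n \<longrightarrow> n \<le> d j + k))"

definition spinal :: "nat \<Rightarrow> (nat \<Rightarrow> nat) \<Rightarrow> bool" where
  "spinal n d \<longleftrightarrow> (\<forall>k j. 1 \<le> k \<longrightarrow> k < j \<longrightarrow> j < n \<longrightarrow> n \<le> d k + j \<longrightarrow> n \<le> d j + k)"

lemma spinal_imp_admissible:
  assumes "spinal n d"
  shows "admissible n d"
  unfolding admissible_def
proof (intro allI impI)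
  fix k j assume "1 \<le> k" "k < j" "j < n"
  then have "n \<le> d k + j \<longrightarrow> n \<le> d j + k" using assms unfolding spinal_def by blast
  then show "(d j + k + 1 = n \<longrightarrow> d k + j < n) \<and> (d k + j = n \<longrightarrow> n \<le> d j + k)" by linarith
qed

lemma finite_heights: "finite (heights n)"
  unfolding heights_def by (intro finite_PiE) auto

lemma heights_less: "d \<in> heights n \<Longrightarrow> 1 \<le> k \<Longrightarrow> k < n \<Longrightarrow> d k < n"
  unfolding heights_def by auto

text \<open>Both vectors are \<open>undefined\<close> outside \<open>{1..<n}\<close>, so the order
  on functions restricts to the entrywise order and chains of vectors can be taken with respect to
  \<open>\<le>\<close>.\<close>

lemma heights_le_iff:
  assumes "d \<in> heights n" "e \<in> heights n"
  shows "d \<le> e \<longleftrightarrow> (\<forall>k\<in>{1..<n}. d k \<le> e k)"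
proof
  assume R: "\<forall>k\<in>{1..<n}. d k \<le> e k"
  show "d \<le> e"
  proof (rule le_funI)
    fix k show "d k \<le> e k"
      using R assms by (cases "k \<in> {1..<n}") (auto simp: heights_def PiE_def extensional_def)
  qed
qed (auto simp: le_fun_def)

section \<open>Arrows of the tableau of an admissible vector\<close>

lemma mem_tableau:
  "(i, j) \<in> tableau n d \<longleftrightarrow> i = 1 \<and> j = n \<or>
     (\<exists>k. 1 \<le> k \<and> k < n \<and> i = k + 1 \<and> j = leftmost n d k) \<or>
     (1 \<le> j \<and> j < n \<and> i = topmost n d j)"
  unfolding tableau_def root_def by auto

lemma leftmost_mem: "1 \<le> k \<Longrightarrow> k < n \<Longrightarrow> (k + 1, leftmost n d k) \<in> tableau n d"
  and topmost_mem: "1 \<le> k \<Longrightarrow> k < n \<Longrightarrow> (topmost n d k, k) \<in> tableau n d"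
  by (auto simp: mem_tableau)

text \<open>A cell of row \<open>k + 1\<close> other than its left-arrow is the up-arrow of column
  \<open>k\<close>, hence the border cell, or of a column \<open>c > k\<close>; in the latter case
  the first clause of \<open>admissible\<close> puts the left-arrow strictly to its left.\<close>

lemma leftmost_ge:
  assumes "admissible n d" "1 \<le> k" "k < n" "(k + 1, c) \<in> tableau n d"
  shows "c \<le> leftmost n d k"
  using assms(4) unfolding mem_tableau
proof (elim disjE exE conjE)
  assume c: "1 \<le> c" "c < n" "k + 1 = topmost n d c"
  show ?thesis
  proof (cases "c = k")
    case False
    then have "d c + k + 1 = n" "k < c" using c by (auto simp: topmost_def min_def split: if_splits)
    then have "d k + c < n" using assms c unfolding admissible_def by blast
    then show ?thesis by (simp add: leftmost_def)
  qed (simp add: leftmost_def)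
qed (use assms in auto)

lemma topmost_le:
  assumes "admissible n d" "1 \<le> k" "k < n" "(r, k) \<in> tableau n d"
  shows "topmost n d k \<le> r"
  using assms(4) unfolding mem_tableau
proof (elim disjE exE conjE)
  fix i assume i: "1 \<le> i" "i < n" "r = i + 1" "k = leftmost n d i"
  show ?thesis
  proof (cases "i = k")
    case False
    then have "d i + k = n" "i < k" using i assms by (auto simp: leftmost_def max_def split: if_splits)
    then have "n \<le> d k + i" using assms i unfolding admissible_def by blast
    then show ?thesis using i by (simp add: topmost_def)
  qed (use i in \<open>simp add: topmost_def\<close>)
qed (use assms in auto)

lemma leftmost_bounds: "1 \<le> k \<Longrightarrow> k < n \<Longrightarrow> k \<le> leftmost n d k \<and> leftmost n d k \<le> n"
  by (auto simp: leftmost_def)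

lemma topmost_bounds: "d \<in> heights n \<Longrightarrow> 1 \<le> k \<Longrightarrow> k < n \<Longrightarrow> 1 \<le> topmost n d k \<and> topmost n d k \<le> k + 1"
  using heights_less[of d n k] by (auto simp: topmost_def)

text \<open>Used both as the support condition of an fb-tableau and to exclude these cells from the
  up-arrows. The witness is the root in column \<open>n\<close>, and otherwise the up-arrow of the
  column containing the cell: it has already moved up if the cell is a border cell, and it is above
  a crossing cell by the second clause of \<open>admissible\<close>.\<close>

lemma leftmost_supported:
  assumes "admissible n d" "1 \<le> k" "k < n"
  shows "\<exists>c\<in>tableau n d. above c (k + 1, leftmost n d k)"
proof -
  let ?j = "leftmost n d k"
  consider "?j = n" | "?j < n" "?j = k" "n \<le> d k + k" | "k < ?j" "?j < n" "d k + ?j = n"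
    using assms by (cases "k \<le> n - d k"; fastforce simp: leftmost_def)
  then show ?thesis
  proof cases
    case 1
    then show ?thesis using assms by (intro bexI[of _ "root n"]) (auto simp: above_def root_def tableau_def)
  next
    case 2
    then show ?thesis using assms topmost_mem[of k n d]
      by (intro bexI[of _ "(topmost n d k, k)"]) (auto simp: above_def topmost_def)
  next
    case 3
    then have "n \<le> d ?j + k" using assms unfolding admissible_def by blast
    then show ?thesis using assms 3 topmost_mem[of ?j n d]
      by (intro bexI[of _ "(topmost n d ?j, ?j)"]) (auto simp: above_def topmost_def)
  qed
qed

lemma topmost_supported:
  assumes "admissible n d" "d \<in> heights n" "1 \<le> k" "k < n"
  shows "\<exists>c\<in>tableau n d. left_of c (topmost n d k, k)"
proof -
  have "d k < n" using assms heights_less by blast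
  consider "topmost n d k = 1" | "topmost n d k = k + 1" "d k + k < n"
    | i where "1 \<le> i" "i < k" "topmost n d k = i + 1" "d k + i + 1 = n"
  proof (cases "d k + k < n")
    case False
    show ?thesis
    proof (cases "n - d k = 1")
      case False
      with \<open>\<not> d k + k < n\<close> \<open>d k < n\<close> show ?thesis
        by (intro that(3)[of "n - d k - 1"]) (auto simp: topmost_def)
    qed (use that(1) in \<open>auto simp: topmost_def\<close>)
  qed (use that(2) in \<open>auto simp: topmost_def\<close>)
  then show ?thesis
  proof cases
    case 1
    then show ?thesis using assms by (intro bexI[of _ "root n"]) (auto simp: left_of_def root_def tableau_def)
  next
    case 2
    then show ?thesis using assms leftmost_mem[of k n d]
      by (intro bexI[of _ "(k + 1, leftmost n d k)"]) (auto simp: left_of_def leftmost_def)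
  next
    case 3
    then have "d i + k < n" using assms unfolding admissible_def by blast
    then show ?thesis using assms 3 leftmost_mem[of i n d]
      by (intro bexI[of _ "(i + 1, leftmost n d i)"]) (auto simp: left_of_def leftmost_def)
  qed
qed

lemma left_arrows_tableau:
  assumes "admissible n d" "d \<in> heights n"
  shows "left_arrows n (tableau n d) = (\<lambda>k. (k + 1, leftmost n d k)) ` {1..<n}"
proof (intro equalityI subsetI)
  fix x assume x: "x \<in> left_arrows n (tableau n d)"
  obtain i j where ij: "x = (i, j)" by force
  have "\<not> (1 \<le> j \<and> j < n \<and> i = topmost n d j)"
    using topmost_supported[OF assms] x ij unfolding left_arrows_def by blast
  then show "x \<in> (\<lambda>k. (k + 1, leftmost n d k)) ` {1..<n}"
    using x unfolding ij left_arrows_def mem_Collect_eq mem_tableau root_def by auto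
next
  fix x assume "x \<in> (\<lambda>k. (k + 1, leftmost n d k)) ` {1..<n}"
  then obtain k where k: "1 \<le> k" "k < n" "x = (k + 1, leftmost n d k)" by auto
  show "x \<in> left_arrows n (tableau n d)"
    using k leftmost_mem[OF k(1,2), of d] leftmost_ge[OF assms(1) k(1,2)]
    by (auto simp: left_arrows_def root_def left_of_def not_less)
qed

lemma up_arrows_tableau:
  assumes "admissible n d" "d \<in> heights n"
  shows "up_arrows n (tableau n d) = (\<lambda>k. (topmost n d k, k)) ` {1..<n}"
proof (intro equalityI subsetI)
  fix x assume x: "x \<in> up_arrows n (tableau n d)"
  obtain i j where ij: "x = (i, j)" by force
  have "\<not> (\<exists>k. 1 \<le> k \<and> k < n \<and> i = k + 1 \<and> j = leftmost n d k)"
    using leftmost_supported[OF assms(1)] x ij unfolding up_arrows_def by blast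
  then show "x \<in> (\<lambda>k. (topmost n d k, k)) ` {1..<n}"
    using x unfolding ij up_arrows_def mem_Collect_eq mem_tableau root_def by auto
next
  fix x assume "x \<in> (\<lambda>k. (topmost n d k, k)) ` {1..<n}"
  then obtain k where k: "1 \<le> k" "k < n" "x = (topmost n d k, k)" by auto
  show "x \<in> up_arrows n (tableau n d)"
    using k topmost_mem[OF k(1,2), of d] topmost_le[OF assms(1) k(1,2)]
    by (auto simp: up_arrows_def root_def above_def not_less)
qed

lemma tableau_in_sTam:
  assumes "admissible n d" "d \<in> heights n" "1 \<le> n"
  shows "tableau n d \<in> sTam n"
proof -
  have "tableau n d \<subseteq> board n"
  proof
    fix x assume "x \<in> tableau n d"
    then consider "x = (1, n)" | k where "1 \<le> k" "k < n" "x = (k + 1, leftmost n d k)"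
      | k where "1 \<le> k" "k < n" "x = (topmost n d k, k)"
      unfolding tableau_def root_def by auto
    then show "x \<in> board n"
    proof cases
      case (2 k)
      then show ?thesis using leftmost_bounds[of k n d] by (auto simp: board_def)
    next
      case (3 k)
      then show ?thesis using topmost_bounds[OF assms(2), of k] by (auto simp: board_def)
    qed (use assms(3) in \<open>simp add: board_def\<close>)
  qed
  moreover have "border n \<subseteq> tableau n d"
  proof
    fix x assume "x \<in> border n"
    then obtain k where k: "1 \<le> k" "k < n" "x = (k + 1, k)"
      unfolding border_def using that by (fastforce simp: numeral_2_eq_2 Suc_le_eq dest: less_imp_Suc_add)
    show "x \<in> tableau n d"
    proof (cases "d k + k < n")
      case True
      then have "topmost n d k = k + 1" by (simp add: topmost_def)
      then show ?thesis using topmost_mem[OF k(1,2), of d] k by simp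
    next
      case False
      then have "leftmost n d k = k" by (simp add: leftmost_def)
      then show ?thesis using leftmost_mem[OF k(1,2), of d] k by simp
    qed
  qed
  moreover have "\<exists>y\<in>tableau n d. left_of y x \<or> above y x" if "x \<in> tableau n d" "x \<noteq> root n" for x
  proof -
    from that consider k where "1 \<le> k" "k < n" "x = (k + 1, leftmost n d k)"
      | k where "1 \<le> k" "k < n" "x = (topmost n d k, k)"
      unfolding tableau_def by auto
    then show ?thesis
      using leftmost_supported[OF assms(1)] topmost_supported[OF assms(1,2)] by cases blast+
  qed
  moreover have "dots n (tableau n d) = {root n}"
  proof -
    have "root n \<notin> left_arrows n (tableau n d)" "root n \<notin> up_arrows n (tableau n d)"
      by (auto simp: left_arrows_def up_arrows_def)
    moreover have "tableau n d = insert (root n) (left_arrows n (tableau n d) \<union> up_arrows n (tableau n d))"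
      unfolding left_arrows_tableau[OF assms(1,2)] up_arrows_tableau[OF assms(1,2)]
      by (rule tableau_def)
    ultimately show ?thesis unfolding dots_def by blast
  qed
  ultimately show ?thesis unfolding sTam_def fb_tableau_def by (auto simp: tableau_def)
qed

section \<open>Recovering the vector from a small tableau\<close>

lemma small_tableau_arrows:
  assumes "T \<in> sTam n" "x \<in> T" "x \<noteq> root n"
  shows "x \<in> left_arrows n T \<longleftrightarrow> x \<notin> up_arrows n T"
proof -
  \<comment> \<open>Smallness makes the cell at least one kind of arrow; the support condition makes
    it at most one.\<close>
  have "x \<in> left_arrows n T \<or> x \<in> up_arrows n T"
    using assms unfolding sTam_def dots_def by blast
  moreover have "\<exists>y\<in>T. left_of y x \<or> above y x"
    using assms unfolding sTam_def fb_tableau_def by blast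
  ultimately show ?thesis unfolding left_arrows_def up_arrows_def by blast
qed

text \<open>The extreme cells \<open>L k\<close> and \<open>U k\<close> account for all cells
  besides the root. That no cell is a double arrow is exploited twice: at border cells
  (\<open>flip\<close>) it leaves one free position per hook, and at crossing cells
  (\<open>clash\<close>) it yields admissibility.\<close>

lemma sTam_imp_tableau:
  assumes "T \<in> sTam n" "1 \<le> n"
  shows "\<exists>d\<in>heights n. admissible n d \<and> T = tableau n d"
proof -
  have board: "1 \<le> i \<and> i \<le> n \<and> 1 \<le> j \<and> j \<le> n \<and> i \<le> j + 1" if "(i, j) \<in> T" for i j
    using assms that unfolding sTam_def fb_tableau_def board_def by blast
  have rootT: "(1, n) \<in> T" and borderT: "\<And>k. 1 \<le> k \<Longrightarrow> k < n \<Longrightarrow> (k + 1, k) \<in> T"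
    using assms unfolding sTam_def fb_tableau_def root_def border_def by (blast, force)
  define L where "L k = Max {c. (k + 1, c) \<in> T}" for k
  define U where "U k = (LEAST r. (r, k) \<in> T)" for k
  have finL: "finite {c. (k + 1, c) \<in> T}" for k
    using board by (auto intro!: finite_subset[of _ "{..n}"])
  have L: "(k + 1, L k) \<in> T" "k \<le> L k" "L k \<le> n" "\<And>c. (k + 1, c) \<in> T \<Longrightarrow> c \<le> L k"
    if "1 \<le> k" "k < n" for k
  proof -
    show "(k + 1, L k) \<in> T" using Max_in[OF finL[of k]] borderT[OF that] unfolding L_def by blast
    then show "L k \<le> n" using board by blast
    show "\<And>c. (k + 1, c) \<in> T \<Longrightarrow> c \<le> L k" using finL unfolding L_def by simp
    then show "k \<le> L k" using borderT that by blast
  qed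
  have U: "(U k, k) \<in> T" "1 \<le> U k" "U k \<le> k + 1" "\<And>r. (r, k) \<in> T \<Longrightarrow> U k \<le> r"
    if "1 \<le> k" "k < n" for k
  proof -
    show "(U k, k) \<in> T" using borderT[OF that] unfolding U_def by (rule LeastI)
    then show "1 \<le> U k" using board by blast
    show "\<And>r. (r, k) \<in> T \<Longrightarrow> U k \<le> r" unfolding U_def by (rule Least_le)
    then show "U k \<le> k + 1" using borderT that by blast
  qed
  have left: "(i, j) \<in> left_arrows n T \<longleftrightarrow> (\<exists>k. 1 \<le> k \<and> k < n \<and> i = k + 1 \<and> j = L k)" for i j
  proof
    assume l: "(i, j) \<in> left_arrows n T"
    then have ij: "(i, j) \<in> T" "i = 1 \<longrightarrow> j \<noteq> n" "\<And>c. (i, c) \<in> T \<Longrightarrow> c \<le> j"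
      by (auto simp: left_arrows_def root_def left_of_def not_less)
    have "i \<noteq> 1" using ij rootT board by force
    then have "1 \<le> i - 1" "i - 1 < n" "i = (i - 1) + 1" using board[OF ij(1)] by auto
    moreover from this have "j = L (i - 1)" using ij L[of "i - 1"] by (metis le_antisym)
    ultimately show "\<exists>k. 1 \<le> k \<and> k < n \<and> i = k + 1 \<and> j = L k" by blast
  next
    assume "\<exists>k. 1 \<le> k \<and> k < n \<and> i = k + 1 \<and> j = L k"
    then show "(i, j) \<in> left_arrows n T"
      using L by (fastforce simp: left_arrows_def root_def left_of_def)
  qed
  have up: "(i, j) \<in> up_arrows n T \<longleftrightarrow> 1 \<le> j \<and> j < n \<and> i = U j" for i j
  proof
    assume l: "(i, j) \<in> up_arrows n T"
    then have ij: "(i, j) \<in> T" "j = n \<longrightarrow> i \<noteq> 1" "\<And>r. (r, j) \<in> T \<Longrightarrow> i \<le> r"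
      by (auto simp: up_arrows_def root_def above_def not_less)
    have "j \<noteq> n" using ij rootT board by force
    then have "1 \<le> j" "j < n" using board[OF ij(1)] by auto
    moreover from this have "i = U j" using ij U[of j] by (metis le_antisym)
    ultimately show "1 \<le> j \<and> j < n \<and> i = U j" by blast
  next
    assume "1 \<le> j \<and> j < n \<and> i = U j"
    then show "(i, j) \<in> up_arrows n T"
      using U by (fastforce simp: up_arrows_def root_def above_def)
  qed
  have flip: "L k = k \<longleftrightarrow> U k \<noteq> k + 1" if "1 \<le> k" "k < n" for k
  proof -
    have "(k + 1, k) \<in> left_arrows n T \<longleftrightarrow> L k = k" using that by (auto simp: left)
    moreover have "(k + 1, k) \<in> up_arrows n T \<longleftrightarrow> U k = k + 1" using that by (auto simp: up)
    moreover have "(k + 1, k) \<noteq> root n" using that by (simp add: root_def)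
    ultimately show ?thesis using small_tableau_arrows[OF assms(1) borderT[OF that]] by blast
  qed
  have clash: "\<not> (L k = j \<and> U j = k + 1)" if "1 \<le> k" "k < n" "1 \<le> j" "j < n" for k j
  proof
    assume a: "L k = j \<and> U j = k + 1"
    then have "(k + 1, j) \<in> left_arrows n T" "(k + 1, j) \<in> up_arrows n T" "(k + 1, j) \<noteq> root n"
      using that by (auto simp: left up root_def)
    then show False
      using small_tableau_arrows[OF assms(1), of "(k + 1, j)"] L(1)[OF that(1,2)] a by blast
  qed
  \<comment> \<open>By \<open>flip\<close> exactly one of the two arrows is on the border cell, and
    the entry records the position of the other.\<close>
  define d where "d = (\<lambda>k\<in>{1..<n}. if L k = k then n - U k else n - L k)"
  have lm: "leftmost n d k = L k" and tm: "topmost n d k = U k" if "1 \<le> k" "k < n" for k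
    using that flip[OF that] L(2,3)[OF that] U(2,3)[OF that]
    by (auto simp: leftmost_def topmost_def d_def)
  have dh: "d \<in> heights n"
    unfolding heights_def d_def
  proof (intro restrict_PiE_iff[THEN iffD2] ballI)
    fix k assume "k \<in> {1..<n}"
    then have "1 \<le> U k" "1 \<le> L k" "1 \<le> n" using U(2)[of k] L(2)[of k] by auto
    then show "(if L k = k then n - U k else n - L k) \<in> {..<n}" by auto
  qed
  moreover have "admissible n d"
    unfolding admissible_def
  proof (intro allI impI conjI)
    fix k j assume kj: "1 \<le> k" "k < j" "j < n"
    have k: "1 \<le> k" "k < n" and j: "1 \<le> j" "j < n" using kj by auto
    note lj = lm[OF j] tm[OF j] and lk = lm[OF k] tm[OF k]
    {
      assume "d j + k + 1 = n"
      then have "U j = k + 1" using lj kj by (auto simp: topmost_def)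
      \<comment> \<open>The up-arrow of column \<open>j\<close> lies in row \<open>k + 1\<close>, so
        \<open>j \<le> L k\<close>; equality would make it a left-arrow as well.\<close>
      then have "j < L k" using clash[OF k j] L(4)[OF k, of j] U(1)[OF j] by fastforce
      then show "d k + j < n" using lk kj by (auto simp: leftmost_def max_def split: if_splits)
    }
    assume "d k + j = n"
    then have "L k = j" using lk kj by (auto simp: leftmost_def)
    then have "U j < k + 1" using clash[OF k j] U(4)[OF j, of "k + 1"] L(1)[OF k] by fastforce
    then show "n \<le> d j + k" using lj kj by (auto simp: topmost_def min_def split: if_splits)
  qed
  moreover have "T = tableau n d"
  proof (intro equalityI subsetI)
    fix x assume x: "x \<in> T"
    obtain i j where ij: "x = (i, j)" by force
    show "x \<in> tableau n d"
    proof (cases "x = root n")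
      case False
      then have "x \<in> left_arrows n T \<or> x \<in> up_arrows n T"
        using small_tableau_arrows[OF assms(1) x] by blast
      then show ?thesis using left up lm tm unfolding ij mem_tableau by metis
    qed (simp add: tableau_def)
  next
    fix x assume "x \<in> tableau n d"
    then show "x \<in> T" using rootT L(1) U(1) lm tm unfolding tableau_def root_def by auto
  qed
  ultimately show ?thesis by blast
qed

text \<open>Testing the containments on the arrows themselves shows that \<open>Row\<close> compares
  the values of \<open>leftmost\<close> and \<open>Col\<close> those of \<open>topmost\<close>. As
  \<open>d k\<close> grows, one of these two decreases while the other is stationary, so both
  comparisons together amount to \<open>d k \<le> e k\<close>. The dot condition holds because the
  two tableaux have the same set of dots.\<close>

lemma fb_le_tableau_iff:
  assumes "admissible n d" "d \<in> heights n" "admissible n e" "e \<in> heights n" "1 \<le> n"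
  shows "fb_le n (tableau n d) (tableau n e) \<longleftrightarrow> d \<le> e"
proof -
  have Row: "(i, j) \<in> Row n (tableau n d) \<longleftrightarrow> (i, j) \<in> board n \<and> (i = 1 \<or> j \<le> leftmost n d (i - 1))"
    if "admissible n d" "d \<in> heights n" for d i j
  proof -
    have "(\<exists>l\<in>insert (root n) (left_arrows n (tableau n d)). l = (i, j) \<or> left_of l (i, j)) \<longleftrightarrow>
        i = 1 \<and> j \<le> n \<or> (\<exists>k. 1 \<le> k \<and> k < n \<and> i = k + 1 \<and> j \<le> leftmost n d k)"
      unfolding left_arrows_tableau[OF that] by (auto simp: left_of_def root_def le_less)
    moreover have "(\<exists>k. 1 \<le> k \<and> k < n \<and> i = k + 1 \<and> j \<le> leftmost n d k) \<longleftrightarrow>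
        i \<noteq> 1 \<and> j \<le> leftmost n d (i - 1)" if "1 \<le> i" "i \<le> n"
      using that by (cases i) auto
    ultimately have "(\<exists>l\<in>insert (root n) (left_arrows n (tableau n d)). l = (i, j) \<or> left_of l (i, j)) \<longleftrightarrow>
        i = 1 \<or> j \<le> leftmost n d (i - 1)" if "(i, j) \<in> board n"
      using that by (auto simp: board_def)
    then show ?thesis unfolding Row_def mem_Collect_eq by blast
  qed
  have Col: "(i, j) \<in> Col n (tableau n d) \<longleftrightarrow> (i, j) \<in> board n \<and> (j = n \<or> topmost n d j \<le> i)"
    if "admissible n d" "d \<in> heights n" for d i j
  proof -
    have "(\<exists>u\<in>insert (root n) (up_arrows n (tableau n d)). u = (i, j) \<or> above u (i, j)) \<longleftrightarrow>
        j = n \<and> 1 \<le> i \<or> 1 \<le> j \<and> j < n \<and> topmost n d j \<le> i"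
    proof -
      have "u = (i, j) \<or> above u (i, j) \<longleftrightarrow> snd u = j \<and> fst u \<le> i" for u
        by (cases u) (auto simp: above_def)
      then show ?thesis unfolding up_arrows_tableau[OF that] root_def by auto
    qed
    moreover have "\<dots> \<longleftrightarrow> j = n \<or> topmost n d j \<le> i" if "(i, j) \<in> board n"
      using that by (auto simp: board_def)
    ultimately show ?thesis unfolding Col_def mem_Collect_eq by blast
  qed
  have dots: "dots n (tableau n d) = {root n}" "dots n (tableau n e) = {root n}"
    using tableau_in_sTam assms unfolding sTam_def by blast+
  have bL: "(k + 1, leftmost n d k) \<in> board n" and bU: "(topmost n d k, k) \<in> board n"
    if "d \<in> heights n" "1 \<le> k" "k < n" for k d
    using leftmost_bounds[OF that(2,3), of d] topmost_bounds[OF that] that by (auto simp: board_def)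
  have "Row n (tableau n e) \<subseteq> Row n (tableau n d) \<longleftrightarrow> (\<forall>k\<in>{1..<n}. leftmost n e k \<le> leftmost n d k)"
  proof
    assume sub: "Row n (tableau n e) \<subseteq> Row n (tableau n d)"
    show "\<forall>k\<in>{1..<n}. leftmost n e k \<le> leftmost n d k"
    proof
      fix k assume k: "k \<in> {1..<n}"
      then have "(k + 1, leftmost n e k) \<in> Row n (tableau n e)"
        using bL[OF assms(4), of k] by (simp add: Row[OF assms(3,4)])
      then have "(k + 1, leftmost n e k) \<in> Row n (tableau n d)" using sub by blast
      then show "leftmost n e k \<le> leftmost n d k" using k by (simp add: Row[OF assms(1,2)])
    qed
  next
    assume R: "\<forall>k\<in>{1..<n}. leftmost n e k \<le> leftmost n d k"
    show "Row n (tableau n e) \<subseteq> Row n (tableau n d)"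
    proof
      fix x assume x: "x \<in> Row n (tableau n e)"
      obtain i j where ij: "x = (i, j)" by force
      have "i = 1 \<or> i - 1 \<in> {1..<n}" using x unfolding ij Row[OF assms(3,4)] board_def by auto
      then show "x \<in> Row n (tableau n d)"
        using x R unfolding ij Row[OF assms(3,4)] Row[OF assms(1,2)] by (metis order_trans)
    qed
  qed
  moreover have "Col n (tableau n d) \<subseteq> Col n (tableau n e) \<longleftrightarrow> (\<forall>k\<in>{1..<n}. topmost n e k \<le> topmost n d k)"
  proof
    assume sub: "Col n (tableau n d) \<subseteq> Col n (tableau n e)"
    show "\<forall>k\<in>{1..<n}. topmost n e k \<le> topmost n d k"
    proof
      fix k assume k: "k \<in> {1..<n}"
      then have "(topmost n d k, k) \<in> Col n (tableau n d)"
        using bU[OF assms(2), of k] by (simp add: Col[OF assms(1,2)])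
      then have "(topmost n d k, k) \<in> Col n (tableau n e)" using sub by blast
      then show "topmost n e k \<le> topmost n d k" using k by (simp add: Col[OF assms(3,4)])
    qed
  next
    assume R: "\<forall>k\<in>{1..<n}. topmost n e k \<le> topmost n d k"
    show "Col n (tableau n d) \<subseteq> Col n (tableau n e)"
    proof
      fix x assume x: "x \<in> Col n (tableau n d)"
      obtain i j where ij: "x = (i, j)" by force
      have "j = n \<or> j \<in> {1..<n}" using x unfolding ij Col[OF assms(1,2)] board_def by auto
      then show "x \<in> Col n (tableau n e)"
        using x R unfolding ij Col[OF assms(3,4)] Col[OF assms(1,2)] by (metis order_trans)
    qed
  qed
  moreover have "leftmost n e k \<le> leftmost n d k \<and> topmost n e k \<le> topmost n d k \<longleftrightarrow> d k \<le> e k"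
    if "k \<in> {1..<n}" for k
    using that heights_less[OF assms(2), of k] heights_less[OF assms(4), of k]
    unfolding leftmost_def topmost_def by auto
  ultimately show ?thesis
    unfolding fb_le_def dots heights_le_iff[OF assms(2,4)] by blast
qed

section \<open>Maximum chains\<close>

definition weight :: "nat \<Rightarrow> (nat \<Rightarrow> nat) \<Rightarrow> nat" where
  "weight n d = sum d {1..<n}"

lemma heights_upd: "d \<in> heights n \<Longrightarrow> k \<in> {1..<n} \<Longrightarrow> v < n \<Longrightarrow> d(k := v) \<in> heights n"
  unfolding heights_def by (auto simp: PiE_def extensional_def)

text \<open>Stated with sums on both sides because \<open>v\<close> may lie above or below
  \<open>d k\<close>.\<close>

lemma weight_upd:
  assumes "k \<in> {1..<n}"
  shows "weight n (d(k := v)) + d k = weight n d + v"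
proof -
  have "weight n e = e k + sum e ({1..<n} - {k})" for e
    unfolding weight_def using assms by (intro sum.remove) auto
  moreover have "sum (d(k := v)) ({1..<n} - {k}) = sum d ({1..<n} - {k})"
    by (intro sum.cong) auto
  ultimately show ?thesis by simp
qed

lemma weight_le: "d \<in> heights n \<Longrightarrow> weight n d \<le> (n - 1) * (n - 1)"
  unfolding weight_def using sum_bounded_above[of "{1..<n}" d "n - 1"] heights_less[of d n]
  by fastforce

lemma heights_less_witness:
  assumes "d \<in> heights n" "e \<in> heights n" "d \<le> e" "d \<noteq> e"
  obtains k where "k \<in> {1..<n}" "d k < e k"
  using assms heights_le_iff[OF assms(2,1)] by (meson antisym not_le_imp_less)

lemma weight_strict_mono:
  assumes "d \<in> heights n" "e \<in> heights n" "d \<le> e" "d \<noteq> e"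
  shows "weight n d < weight n e"
proof -
  obtain k where "k \<in> {1..<n}" "d k < e k" using heights_less_witness[OF assms] .
  then show ?thesis
    using assms(3) unfolding weight_def le_fun_def by (intro sum_strict_mono_ex1) auto
qed

text \<open>Raising one entry in which \<open>e\<close> exceeds \<open>d\<close> gives a vector
  below \<open>e\<close> of the same weight as \<open>e\<close>, and comparable vectors of equal
  weight coincide.\<close>

lemma weight_unit_step:
  assumes "d \<in> heights n" "e \<in> heights n" "d \<le> e" "weight n e = Suc (weight n d)"
  obtains k where "k \<in> {1..<n}" "e = d(k := Suc (d k))"
proof -
  have "d \<noteq> e" using assms(4) by auto
  then obtain k where k: "k \<in> {1..<n}" "d k < e k" using heights_less_witness assms by metis
  let ?d' = "d(k := Suc (d k))"
  have "?d' \<in> heights n"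
    using heights_upd[OF assms(1) k(1)] k heights_less[OF assms(2), of k] by auto
  moreover have "?d' \<le> e" using assms(3) k by (auto simp: le_fun_def)
  moreover have "weight n ?d' = weight n e" using weight_upd[OF k(1), of d "Suc (d k)"] assms(4) by simp
  ultimately have "e = ?d'" using weight_strict_mono assms(2) by (metis less_irrefl)
  with k show ?thesis using that by blast
qed

text \<open>Entries only grow, so an implication that already had a true premise survives. A premise
  that becomes true does so by a unit step, hence with equality, and there admissibility gives the
  conclusion.\<close>

lemma spinal_step:
  assumes "spinal n d" "admissible n (d(i := Suc (d i)))"
  shows "spinal n (d(i := Suc (d i)))"
  unfolding spinal_def
proof (intro allI impI)
  let ?d = "d(i := Suc (d i))"
  fix k j assume kj: "1 \<le> k" "k < j" "j < n" and ge: "n \<le> ?d k + j"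
  show "n \<le> ?d j + k"
  proof (cases "n \<le> d k + j")
    case True
    then have "n \<le> d j + k" using assms(1) kj unfolding spinal_def by blast
    then show ?thesis by auto
  next
    case False
    then have "?d k + j = n" using ge by (auto split: if_splits)
    then show ?thesis using assms(2) kj unfolding admissible_def by blast
  qed
qed

lemma inj_on_weight_chain:
  assumes "C \<subseteq> heights n" "Complete_Partial_Order.chain (\<le>) C"
  shows "inj_on (weight n) C"
proof (rule inj_onI)
  fix d e assume "d \<in> C" "e \<in> C" "weight n d = weight n e"
  then show "d = e"
    using weight_strict_mono[of d n e] weight_strict_mono[of e n d] assms
    unfolding chain_def by (metis less_irrefl subsetD)
qed

lemma card_chain_le:
  assumes "C \<subseteq> heights n" "Complete_Partial_Order.chain (\<le>) C"
  shows "card C \<le> Suc ((n - 1) * (n - 1))"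
proof -
  have "weight n ` C \<subseteq> {..(n - 1) * (n - 1)}" using assms(1) weight_le by auto
  then have "card (weight n ` C) \<le> card {..(n - 1) * (n - 1)}" by (intro card_mono) auto
  then show ?thesis using card_image[OF inj_on_weight_chain[OF assms]] by simp
qed

text \<open>The weight is injective on a chain, so with this cardinality it takes every value from
  \<open>0\<close> to \<open>(n - 1) * (n - 1)\<close>. Each element of positive weight therefore
  has a predecessor in the chain of weight one less, and \<open>spinal_step\<close> carries
  spinality upwards.\<close>

lemma longest_chain_spinal:
  assumes C: "C \<subseteq> {d \<in> heights n. admissible n d}" "Complete_Partial_Order.chain (\<le>) C"
    and card: "card C = Suc ((n - 1) * (n - 1))" and "d \<in> C"
  shows "spinal n d"
proof -
  have sub: "C \<subseteq> heights n" using C by blast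
  have "weight n ` C \<subseteq> {..(n - 1) * (n - 1)}" using sub weight_le by auto
  then have img: "weight n ` C = {..(n - 1) * (n - 1)}"
    using card card_image[OF inj_on_weight_chain[OF sub C(2)]] by (intro card_subset_eq) auto
  show ?thesis using \<open>d \<in> C\<close>
  proof (induction "weight n d" arbitrary: d)
    case 0
    then have "\<forall>k\<in>{1..<n}. d k = 0" by (simp add: weight_def)
    then show ?case unfolding spinal_def by auto
  next
    case (Suc t)
    then have "Suc t \<le> (n - 1) * (n - 1)" using img by blast
    then have "t \<in> weight n ` C" using img by auto
    then obtain e where e: "e \<in> C" "t = weight n e" by blast
    have "\<not> d \<le> e"
      using weight_strict_mono[of d n e] Suc e sub by (metis less_SucI less_irrefl lessI subsetD less_asym)
    then have "e \<le> d" using C(2) e Suc unfolding chain_def by blast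
    then obtain k where "k \<in> {1..<n}" "d = e(k := Suc (e k))"
      using weight_unit_step[of e n d] Suc e sub by (metis subsetD)
    moreover have "spinal n e" using Suc e by blast
    moreover have "admissible n d" using C Suc by blast
    ultimately show ?case using spinal_step by blast
  qed
qed

section \<open>Completing a spinal vector to a longest chain\<close>

lemma spinal_chain_above:
  assumes "d \<in> heights n" "spinal n d"
  shows "\<exists>C. C \<subseteq> {e \<in> heights n. spinal n e \<and> d \<le> e} \<and> Complete_Partial_Order.chain (\<le>) C \<and>
    d \<in> C \<and> card C + weight n d = Suc ((n - 1) * (n - 1))"
  using assms
proof (induction "(n - 1) * (n - 1) - weight n d" arbitrary: d rule: less_induct)
  case less
  show ?case
  proof (cases "\<forall>k\<in>{1..<n}. d k = n - 1")
    case True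
    then have "weight n d = (n - 1) * (n - 1)" by (simp add: weight_def)
    then show ?thesis using less.prems by (intro exI[of _ "{d}"]) (auto simp: chain_def)
  next
    case False
    define k where "k = Max {k \<in> {1..<n}. d k \<noteq> n - 1}"
    have "k \<in> {k \<in> {1..<n}. d k \<noteq> n - 1}" unfolding k_def using False by (intro Max_in) auto
    then have k: "k \<in> {1..<n}" "d k \<noteq> n - 1" by auto
    have top: "d j = n - 1" if "k < j" "j < n" for j
    proof (rule ccontr)
      assume "d j \<noteq> n - 1"
      then have "j \<le> k" unfolding k_def using that k by (intro Max_ge) auto
      then show False using that by simp
    qed
    have dk: "Suc (d k) < n" using k heights_less[OF less.prems(1), of k] by auto
    let ?d = "d(k := Suc (d k))"
    have dh: "?d \<in> heights n" using heights_upd[OF less.prems(1) k(1) dk] .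
    have w: "weight n ?d = Suc (weight n d)" using weight_upd[OF k(1), of d "Suc (d k)"] by simp
    \<comment> \<open>Raising entry \<open>k\<close> endangers only pairs whose smaller index is
      \<open>k\<close>. All later entries equal \<open>n - 1\<close>, so their conclusions hold
      because the smaller index is at least \<open>1\<close>.\<close>
    have "spinal n ?d"
      unfolding spinal_def
    proof (intro allI impI)
      fix i j assume ij: "1 \<le> i" "i < j" "j < n" and ge: "n \<le> ?d i + j"
      show "n \<le> ?d j + i"
      proof (cases "i = k")
        case True
        then show ?thesis using top[of j] ij by auto
      next
        case False
        then have "n \<le> d j + i" using ge ij less.prems(2) unfolding spinal_def by auto
        then show ?thesis by auto
      qed
    qed
    moreover have "(n - 1) * (n - 1) - weight n ?d < (n - 1) * (n - 1) - weight n d"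
      using weight_le[OF dh] w by linarith
    ultimately obtain C where C: "C \<subseteq> {e \<in> heights n. spinal n e \<and> ?d \<le> e}"
      "Complete_Partial_Order.chain (\<le>) C" "card C + weight n ?d = Suc ((n - 1) * (n - 1))"
      using less.hyps[of ?d] dh by blast
    have "d \<le> ?d" by (auto simp: le_fun_def)
    have "\<not> ?d \<le> d" by (auto simp: le_fun_def)
    then have "d \<notin> C" using C(1) by blast
    moreover have "finite C" using C(1) finite_heights by (auto intro: finite_subset)
    ultimately have "card (insert d C) + weight n d = Suc ((n - 1) * (n - 1))" using C(3) w by simp
    moreover have "insert d C \<subseteq> {e \<in> heights n. spinal n e \<and> d \<le> e}"
      using C(1) less.prems \<open>d \<le> ?d\<close> by (auto intro: order_trans)
    moreover from this have "Complete_Partial_Order.chain (\<le>) (insert d C)"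
      using C(2) unfolding chain_def by blast
    ultimately show ?thesis by blast
  qed
qed

lemma spinal_chain_below:
  assumes "d \<in> heights n" "spinal n d"
  shows "\<exists>C. C \<subseteq> {e \<in> heights n. spinal n e \<and> e \<le> d} \<and> Complete_Partial_Order.chain (\<le>) C \<and>
    d \<in> C \<and> card C = Suc (weight n d)"
  using assms
proof (induction "weight n d" arbitrary: d rule: less_induct)
  case less
  show ?case
  proof (cases "\<forall>k\<in>{1..<n}. d k = 0")
    case True
    then have "weight n d = 0" by (simp add: weight_def)
    then show ?thesis using less.prems by (intro exI[of _ "{d}"]) (auto simp: chain_def)
  next
    case False
    define k where "k = Min {k \<in> {1..<n}. d k \<noteq> 0}"
    have "k \<in> {k \<in> {1..<n}. d k \<noteq> 0}" unfolding k_def using False by (intro Min_in) auto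
    then have k: "k \<in> {1..<n}" "d k \<noteq> 0" by auto
    have bottom: "d j = 0" if "1 \<le> j" "j < k" for j
    proof (rule ccontr)
      assume "d j \<noteq> 0"
      then have "k \<le> j" unfolding k_def using that k by (intro Min_le) auto
      then show False using that by simp
    qed
    have dk: "d k - 1 < n" using k heights_less[OF less.prems(1), of k] by auto
    let ?d = "d(k := d k - 1)"
    have dh: "?d \<in> heights n" using heights_upd[OF less.prems(1) k(1) dk] .
    have w: "weight n d = Suc (weight n ?d)" using weight_upd[OF k(1), of d "d k - 1"] k by simp
    have "spinal n ?d"
      unfolding spinal_def
    proof (intro allI impI)
      fix i j assume ij: "1 \<le> i" "i < j" "j < n" and ge: "n \<le> ?d i + j"
      then have "n \<le> d i + j" by (auto split: if_splits)
      then have "n \<le> d j + i" using ij less.prems(2) unfolding spinal_def by auto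
      \<comment> \<open>Lowering entry \<open>k\<close> endangers only pairs whose larger index is
        \<open>k\<close>; there the smaller entry is \<open>0\<close>, which refutes the
        premise.\<close>
      moreover have "j \<noteq> k" using bottom[of i] ij \<open>n \<le> d i + j\<close> by auto
      ultimately show "n \<le> ?d j + i" by simp
    qed
    then obtain C where C: "C \<subseteq> {e \<in> heights n. spinal n e \<and> e \<le> ?d}"
      "Complete_Partial_Order.chain (\<le>) C" "card C = Suc (weight n ?d)"
      using less.hyps[of ?d] dh w by auto
    have "?d \<le> d" by (auto simp: le_fun_def)
    have "\<not> d k \<le> ?d k" using k by simp
    then have "\<not> d \<le> ?d" unfolding le_fun_def by blast
    then have "d \<notin> C" using C(1) by blast
    moreover have "finite C" using C(1) finite_heights by (auto intro: finite_subset)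
    ultimately have "card (insert d C) = Suc (weight n d)" using C(3) w by simp
    moreover have "insert d C \<subseteq> {e \<in> heights n. spinal n e \<and> e \<le> d}"
      using C(1) less.prems \<open>?d \<le> d\<close> by (auto intro: order_trans)
    moreover from this have "Complete_Partial_Order.chain (\<le>) (insert d C)"
      using C(2) unfolding chain_def by blast
    ultimately show ?thesis by blast
  qed
qed

lemma spinal_in_longest_chain:
  assumes "d \<in> heights n" "spinal n d"
  shows "\<exists>C. C \<subseteq> {e \<in> heights n. spinal n e} \<and> Complete_Partial_Order.chain (\<le>) C \<and>
    d \<in> C \<and> card C = Suc ((n - 1) * (n - 1))"
proof -
  obtain A where A: "A \<subseteq> {e \<in> heights n. spinal n e \<and> d \<le> e}" "Complete_Partial_Order.chain (\<le>) A"
    "d \<in> A" "card A + weight n d = Suc ((n - 1) * (n - 1))"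
    using spinal_chain_above[OF assms] by blast
  obtain B where B: "B \<subseteq> {e \<in> heights n. spinal n e \<and> e \<le> d}" "Complete_Partial_Order.chain (\<le>) B"
    "d \<in> B" "card B = Suc (weight n d)"
    using spinal_chain_below[OF assms] by blast
  have "finite A" "finite B" using A(1) B(1) finite_heights by (auto intro: finite_subset)
  moreover have "A \<inter> B = {d}" using A(1,3) B(1,3) by (auto intro: order_antisym)
  \<comment> \<open>The common element \<open>d\<close> is counted once, so the two weight
    contributions cancel.\<close>
  ultimately have "card (A \<union> B) = Suc ((n - 1) * (n - 1))"
    using card_Un_Int[of A B] A(4) B(4) by simp
  moreover have "Complete_Partial_Order.chain (\<le>) (A \<union> B)"
    unfolding chain_def
  proof (intro ballI)
    fix x y assume "x \<in> A \<union> B" "y \<in> A \<union> B"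
    then consider "x \<in> A" "y \<in> A" | "x \<in> B" "y \<in> B" | "x \<in> A" "y \<in> B" | "x \<in> B" "y \<in> A" by blast
    then show "x \<le> y \<or> y \<le> x"
    proof cases
      case 3
      then have "d \<le> x" "y \<le> d" using A(1) B(1) by auto
      then show ?thesis by auto
    next
      case 4
      then have "x \<le> d" "d \<le> y" using A(1) B(1) by auto
      then show ?thesis by auto
    qed (use A(2) B(2) in \<open>auto simp: chain_def\<close>)
  qed
  ultimately show ?thesis using A(1,3) B(1) by (intro exI[of _ "A \<union> B"]) auto
qed

section \<open>Transfer of chains between vectors and tableaux\<close>

lemma inj_on_tableau: "1 \<le> n \<Longrightarrow> inj_on (tableau n) {d \<in> heights n. admissible n d}"
proof (rule inj_onI)
  fix d e assume n: "1 \<le> n" and d: "d \<in> {d \<in> heights n. admissible n d}"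
    and e: "e \<in> {d \<in> heights n. admissible n d}" and eq: "tableau n d = tableau n e"
  \<comment> \<open>An order embedding is injective: equal tableaux are related in both directions,
    hence so are their vectors.\<close>
  have "fb_le n (tableau n d) (tableau n d)" using fb_le_tableau_iff d n by blast
  then have "d \<le> e" "e \<le> d" using fb_le_tableau_iff[of n d e] fb_le_tableau_iff[of n e d] d e n eq by auto
  then show "d = e" by (rule order_antisym)
qed

lemma sTam_eq: "1 \<le> n \<Longrightarrow> sTam n = tableau n ` {d \<in> heights n. admissible n d}"
  using sTam_imp_tableau tableau_in_sTam by blast

lemma sTam_chain_tableau:
  assumes "1 \<le> n" "C \<subseteq> {d \<in> heights n. admissible n d}"
  shows "sTam_chain n (tableau n ` C) \<longleftrightarrow> Complete_Partial_Order.chain (\<le>) C"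
proof -
  have "fb_le n (tableau n d) (tableau n e) \<longleftrightarrow> d \<le> e" if "d \<in> C" "e \<in> C" for d e
    using fb_le_tableau_iff assms that by blast
  moreover have "tableau n ` C \<subseteq> sTam n" using sTam_eq[OF assms(1)] assms(2) by blast
  ultimately show ?thesis unfolding sTam_chain_def chain_def by simp
qed

lemma sTam_chain_imp_tableau:
  assumes "1 \<le> n" "sTam_chain n D"
  obtains C where "C \<subseteq> {d \<in> heights n. admissible n d}" "D = tableau n ` C"
    "Complete_Partial_Order.chain (\<le>) C" "card D = card C"
proof -
  have "D \<subseteq> tableau n ` {d \<in> heights n. admissible n d}"
    using assms sTam_eq by (simp add: sTam_chain_def)
  then obtain C where C: "C \<subseteq> {d \<in> heights n. admissible n d}" "D = tableau n ` C"
    by (meson subset_imageE)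
  moreover have "inj_on (tableau n) C" using inj_on_subset[OF inj_on_tableau[OF assms(1)] C(1)] .
  ultimately show ?thesis using that sTam_chain_tableau[OF assms(1) C(1)] assms(2) card_image by blast
qed

lemma spine_eq:
  assumes "1 \<le> n"
  shows "spine n = tableau n ` {d \<in> heights n. spinal n d}"
proof -
  let ?l = "Suc ((n - 1) * (n - 1))"
  have bound: "card D \<le> ?l" if D: "sTam_chain n D" for D
  proof -
    obtain C where C: "C \<subseteq> {d \<in> heights n. admissible n d}"
      "Complete_Partial_Order.chain (\<le>) C" "card D = card C"
      using sTam_chain_imp_tableau[OF assms D] by blast
    then have "C \<subseteq> heights n" by blast
    then show ?thesis using card_chain_le C by metis
  qed
  have exists: "\<exists>D. sTam_chain n D \<and> card D = ?l \<and> tableau n d \<in> D"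
    if d: "d \<in> heights n" "spinal n d" for d
  proof -
    obtain C where C: "C \<subseteq> {e \<in> heights n. spinal n e}" "Complete_Partial_Order.chain (\<le>) C"
      "d \<in> C" "card C = ?l"
      using spinal_in_longest_chain[OF d] by blast
    have sub: "C \<subseteq> {e \<in> heights n. admissible n e}" using C(1) spinal_imp_admissible by blast
    have "card (tableau n ` C) = ?l"
      using card_image[OF inj_on_subset[OF inj_on_tableau[OF assms] sub]] C(4) by simp
    then show ?thesis using sTam_chain_tableau[OF assms sub] C(2,3) by blast
  qed
  \<comment> \<open>A chain through the zero vector shows that the bound \<open>?l\<close> is
    attained, so that chains of maximum length are exactly those with \<open>?l\<close>
    elements.\<close>
  have "(\<lambda>k\<in>{1..<n}. 0) \<in> heights n" "spinal n (\<lambda>k\<in>{1..<n}. 0)"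
    by (auto simp: heights_def spinal_def)
  then obtain D where D: "sTam_chain n D" "card D = ?l" using exists by blast
  show ?thesis
  proof (intro equalityI subsetI)
    fix T assume "T \<in> spine n"
    then obtain E where E: "sTam_chain n E" "card D \<le> card E" "T \<in> E"
      using D(1) unfolding spine_def by blast
    then have card: "card E = ?l" using bound[OF E(1)] D(2) by simp
    obtain C where C: "C \<subseteq> {d \<in> heights n. admissible n d}" "E = tableau n ` C"
      "Complete_Partial_Order.chain (\<le>) C" "card E = card C"
      using sTam_chain_imp_tableau[OF assms E(1)] .
    then have "spinal n d" if "d \<in> C" for d using longest_chain_spinal[OF C(1,3)] card that by simp
    then show "T \<in> tableau n ` {d \<in> heights n. spinal n d}" using E(3) C(1,2) by blast
  next
    fix T assume "T \<in> tableau n ` {d \<in> heights n. spinal n d}"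
    then obtain E where "sTam_chain n E" "card E = ?l" "T \<in> E" using exists by blast
    then show "T \<in> spine n" using bound unfolding spine_def by auto
  qed
qed

section \<open>Counting disjoint bars in a rectangle\<close>

text \<open>
  Bars of length \<open>s a\<close> starting at the left end of row \<open>a\<close> and bars of height \<open>u c\<close> hanging from the
  top of column \<open>c\<close> in an \<open>m \<times> q\<close> rectangle, all horizontal bars being disjoint from all vertical ones.
\<close>

definition bars :: "nat \<Rightarrow> nat \<Rightarrow> ((nat \<Rightarrow> nat) \<times> (nat \<Rightarrow> nat)) set" where
  "bars m q = {(s, u). s \<in> {1..m} \<rightarrow>\<^sub>E {..q} \<and> u \<in> {1..q} \<rightarrow>\<^sub>E {..m} \<and>
     (\<forall>a\<in>{1..m}. \<forall>c\<in>{1..q}. a \<le> u c \<longrightarrow> s a < c)}"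

text \<open>For positive \<open>m\<close>, these are the families in which some vertical bar reaches
  the last row and so restricts the horizontal bar there.\<close>

definition full_bars :: "nat \<Rightarrow> nat \<Rightarrow> ((nat \<Rightarrow> nat) \<times> (nat \<Rightarrow> nat)) set" where
  "full_bars m q = {(s, u) \<in> bars m q. \<exists>c\<in>{1..q}. u c = m}"

lemma finite_bars: "finite (bars m q)"
proof (rule finite_subset)
  show "bars m q \<subseteq> ({1..m} \<rightarrow>\<^sub>E {..q}) \<times> ({1..q} \<rightarrow>\<^sub>E {..m})" by (auto simp: bars_def)
qed (auto intro: finite_PiE)

lemma card_bars_0_left: "card (bars 0 q) = 1"
proof -
  have "bars 0 q = {(\<lambda>_. undefined, \<lambda>c\<in>{1..q}. 0)}"
    unfolding bars_def by (auto simp: PiE_def extensional_def fun_eq_iff)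
  then show ?thesis by simp
qed

lemma card_bars_0_right: "card (bars m 0) = 1"
proof -
  have "bars m 0 = {(\<lambda>c\<in>{1..m}. 0, \<lambda>_. undefined)}"
    unfolding bars_def by (auto simp: PiE_def extensional_def fun_eq_iff)
  then show ?thesis by simp
qed

text \<open>Deleting the last coordinate of an extensional function means resetting it to
  \<open>undefined\<close>; the bijections that delete a row or a column have this form.\<close>

lemma PiE_Suc_iff:
  "s \<in> {1..Suc m} \<rightarrow>\<^sub>E B \<longleftrightarrow> s (Suc m) \<in> B \<and> s(Suc m := undefined) \<in> {1..m} \<rightarrow>\<^sub>E B"
proof -
  have "{1..Suc m} = insert (Suc m) {1..m}" by auto
  then show ?thesis by (auto simp: PiE_iff extensional_def)
qed

lemma PiE_Suc_undefined: "s \<in> {1..m} \<rightarrow>\<^sub>E B \<Longrightarrow> s(Suc m := undefined) = s"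
  by (auto simp: PiE_def extensional_def fun_eq_iff)

lemma PiE_mono_right: "s \<in> A \<rightarrow>\<^sub>E {..q} \<Longrightarrow> q \<le> r \<Longrightarrow> s \<in> A \<rightarrow>\<^sub>E {..r::nat}"
  by (auto simp: PiE_iff)

text \<open>No vertical bar reaches the last row, so its horizontal bar can have any of the
  \<open>q + 1\<close> lengths and the row can be deleted.\<close>

lemma card_bars_not_full: "card (bars (Suc m) q - full_bars (Suc m) q) = Suc q * card (bars m q)"
proof -
  have "bij_betw (\<lambda>(t, s, u). (s(Suc m := t), u)) ({..q} \<times> bars m q)
      (bars (Suc m) q - full_bars (Suc m) q)"
  proof (rule bij_betw_byWitness[where f' = "\<lambda>(s, u). (s (Suc m), s(Suc m := undefined), u)"])
    show "\<forall>x\<in>{..q} \<times> bars m q. (\<lambda>(s, u). (s (Suc m), s(Suc m := undefined), u))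
        ((\<lambda>(t, s, u). (s(Suc m := t), u)) x) = x"
      by (auto simp: bars_def PiE_Suc_undefined)
    show "(\<lambda>(t, s, u). (s(Suc m := t), u)) ` ({..q} \<times> bars m q) \<subseteq> bars (Suc m) q - full_bars (Suc m) q"
    proof (rule image_subsetI, simp only: split_paired_all prod.case)
      fix t s u assume "(t, s, u) \<in> {..q} \<times> bars m q"
      then have t: "t \<in> {..q}" and s: "s \<in> {1..m} \<rightarrow>\<^sub>E {..q}" and u: "u \<in> {1..q} \<rightarrow>\<^sub>E {..m}"
        and su: "\<forall>a\<in>{1..m}. \<forall>c\<in>{1..q}. a \<le> u c \<longrightarrow> s a < c"
        by (auto simp: bars_def)
      have um: "u c \<le> m" if "c \<in> {1..q}" for c using u that by auto
      have "s(Suc m := t) \<in> {1..Suc m} \<rightarrow>\<^sub>E {..q}"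
        using s t by (simp only: PiE_Suc_iff) (simp add: PiE_Suc_undefined)
      moreover have "u \<in> {1..q} \<rightarrow>\<^sub>E {..Suc m}" using PiE_mono_right[OF u] by simp
      moreover have "(s(Suc m := t)) a < c" if "a \<in> {1..Suc m}" "c \<in> {1..q}" "a \<le> u c" for a c
        using su um[of c] that by (cases "a = Suc m") auto
      moreover have "\<not> (\<exists>c\<in>{1..q}. u c = Suc m)" using um by fastforce
      ultimately show "(s(Suc m := t), u) \<in> bars (Suc m) q - full_bars (Suc m) q"
        unfolding bars_def full_bars_def by auto
    qed
    show "(\<lambda>(s, u). (s (Suc m), s(Suc m := undefined), u)) ` (bars (Suc m) q - full_bars (Suc m) q)
        \<subseteq> {..q} \<times> bars m q"
    proof (rule image_subsetI, simp only: split_paired_all prod.case)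
      fix s u assume "(s, u) \<in> bars (Suc m) q - full_bars (Suc m) q"
      then have s: "s \<in> {1..Suc m} \<rightarrow>\<^sub>E {..q}" and u: "u \<in> {1..q} \<rightarrow>\<^sub>E {..Suc m}"
        and su: "\<forall>a\<in>{1..Suc m}. \<forall>c\<in>{1..q}. a \<le> u c \<longrightarrow> s a < c" and "\<forall>c\<in>{1..q}. u c \<noteq> Suc m"
        by (auto simp: bars_def full_bars_def)
      then have "u \<in> {1..q} \<rightarrow>\<^sub>E {..m}" by (fastforce simp: PiE_iff le_Suc_eq)
      then show "(s (Suc m), s(Suc m := undefined), u) \<in> {..q} \<times> bars m q"
        using s[unfolded PiE_Suc_iff] su by (auto simp: bars_def)
    qed
  qed auto
  then show ?thesis using bij_betw_same_card by (fastforce simp: card_cartesian_product)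
qed

text \<open>
  If some column before the last is full, no row reaches the last column, whose bar is then
  arbitrary. Otherwise only the last column is full, so the last row and the last column can be deleted.
\<close>

lemma card_full_bars_Suc:
  "card (full_bars (Suc m) (Suc q)) = (m + 2) * card (full_bars (Suc m) q) + Suc q * card (bars m q)"
proof -
  let ?F = "full_bars (Suc m) (Suc q)"
  let ?A = "{(s, u) \<in> ?F. \<exists>c\<in>{1..q}. u c = Suc m}"
  have "bij_betw (\<lambda>(t, s, u). (s, u(Suc q := t))) ({..Suc m} \<times> full_bars (Suc m) q) ?A"
  proof (rule bij_betw_byWitness[where f' = "\<lambda>(s, u). (u (Suc q), s, u(Suc q := undefined))"])
    show "\<forall>x\<in>{..Suc m} \<times> full_bars (Suc m) q. (\<lambda>(s, u). (u (Suc q), s, u(Suc q := undefined)))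
        ((\<lambda>(t, s, u). (s, u(Suc q := t))) x) = x"
      by (auto simp: bars_def full_bars_def PiE_Suc_undefined)
    show "(\<lambda>(t, s, u). (s, u(Suc q := t))) ` ({..Suc m} \<times> full_bars (Suc m) q) \<subseteq> ?A"
    proof (rule image_subsetI, simp only: split_paired_all prod.case)
      fix t s u assume "(t, s, u) \<in> {..Suc m} \<times> full_bars (Suc m) q"
      then obtain c where t: "t \<in> {..Suc m}" and s: "s \<in> {1..Suc m} \<rightarrow>\<^sub>E {..q}" and u: "u \<in> {1..q} \<rightarrow>\<^sub>E {..Suc m}"
        and su: "\<forall>a\<in>{1..Suc m}. \<forall>c\<in>{1..q}. a \<le> u c \<longrightarrow> s a < c"
        and c: "c \<in> {1..q}" "u c = Suc m"
        by (auto simp: bars_def full_bars_def)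
      have "s \<in> {1..Suc m} \<rightarrow>\<^sub>E {..Suc q}" using PiE_mono_right[OF s] by simp
      moreover have "u(Suc q := t) \<in> {1..Suc q} \<rightarrow>\<^sub>E {..Suc m}"
        using u t by (simp only: PiE_Suc_iff) (simp add: PiE_Suc_undefined)
      moreover have "s a < Suc q" if "a \<in> {1..Suc m}" for a
        using su[rule_format, of a c] c that by auto
      then have "\<forall>a\<in>{1..Suc m}. \<forall>c\<in>{1..Suc q}. a \<le> (u(Suc q := t)) c \<longrightarrow> s a < c"
        using su by (auto simp: le_Suc_eq)
      moreover have "\<exists>c\<in>{1..q}. (u(Suc q := t)) c = Suc m" "\<exists>c\<in>{1..Suc q}. (u(Suc q := t)) c = Suc m"
        using c by (auto intro!: bexI[of _ c])
      ultimately show "(s, u(Suc q := t)) \<in> ?A"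
        unfolding bars_def full_bars_def mem_Collect_eq case_prod_conv by blast
    qed
    show "(\<lambda>(s, u). (u (Suc q), s, u(Suc q := undefined))) ` ?A \<subseteq> {..Suc m} \<times> full_bars (Suc m) q"
    proof (rule image_subsetI, simp only: split_paired_all prod.case)
      fix s u assume "(s, u) \<in> ?A"
      then obtain c where c: "c \<in> {1..q}" "u c = Suc m" and s: "s \<in> {1..Suc m} \<rightarrow>\<^sub>E {..Suc q}" and u: "u \<in> {1..Suc q} \<rightarrow>\<^sub>E {..Suc m}"
        and su: "\<forall>a\<in>{1..Suc m}. \<forall>c\<in>{1..Suc q}. a \<le> u c \<longrightarrow> s a < c"
        by (auto simp: bars_def full_bars_def)
      have "s a \<le> q" if "a \<in> {1..Suc m}" for a
        using su[rule_format, of a c] c that by auto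
      then have "s \<in> {1..Suc m} \<rightarrow>\<^sub>E {..q}" using s by (auto simp: PiE_iff)
      then show "(u (Suc q), s, u(Suc q := undefined)) \<in> {..Suc m} \<times> full_bars (Suc m) q"
        using u[unfolded PiE_Suc_iff] su c by (auto simp: bars_def full_bars_def)
    qed
  qed auto
  \<comment> \<open>The factor \<open>m + 2\<close> counts the heights \<open>0\<close> to
    \<open>m + 1\<close> of the bar in the last column.\<close>
  then have A: "card ?A = (m + 2) * card (full_bars (Suc m) q)"
    using bij_betw_same_card by (fastforce simp: card_cartesian_product)
  have "bij_betw (\<lambda>(t, s, u). (s(Suc m := t), u(Suc q := Suc m))) ({..q} \<times> bars m q) (?F - ?A)"
  proof (rule bij_betw_byWitness[where
        f' = "\<lambda>(s, u). (s (Suc m), s(Suc m := undefined), u(Suc q := undefined))"])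
    show "\<forall>x\<in>{..q} \<times> bars m q. (\<lambda>(s, u). (s (Suc m), s(Suc m := undefined), u(Suc q := undefined)))
        ((\<lambda>(t, s, u). (s(Suc m := t), u(Suc q := Suc m))) x) = x"
      by (auto simp: bars_def PiE_Suc_undefined)
    show "\<forall>x\<in>?F - ?A. (\<lambda>(t, s, u). (s(Suc m := t), u(Suc q := Suc m)))
        ((\<lambda>(s, u). (s (Suc m), s(Suc m := undefined), u(Suc q := undefined))) x) = x"
    proof (rule ballI, simp only: split_paired_all prod.case)
      fix s u assume "(s, u) \<in> ?F - ?A"
      then have "\<exists>c\<in>{1..Suc q}. u c = Suc m" "\<forall>c\<in>{1..q}. u c \<noteq> Suc m"
        unfolding full_bars_def by blast+
      then have "u (Suc q) = Suc m" by (metis atLeastAtMost_iff le_Suc_eq)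
      then show "((s(Suc m := undefined))(Suc m := s (Suc m)),
          (u(Suc q := undefined))(Suc q := Suc m)) = (s, u)"
        by (simp add: fun_eq_iff)
    qed
    show "(\<lambda>(t, s, u). (s(Suc m := t), u(Suc q := Suc m))) ` ({..q} \<times> bars m q) \<subseteq> ?F - ?A"
    proof (rule image_subsetI, simp only: split_paired_all prod.case)
      fix t s u assume "(t, s, u) \<in> {..q} \<times> bars m q"
      then have t: "t \<in> {..q}" and s: "s \<in> {1..m} \<rightarrow>\<^sub>E {..q}" and u: "u \<in> {1..q} \<rightarrow>\<^sub>E {..m}"
        and su: "\<forall>a\<in>{1..m}. \<forall>c\<in>{1..q}. a \<le> u c \<longrightarrow> s a < c"
        by (auto simp: bars_def)
      let ?s = "s(Suc m := t)" and ?u = "u(Suc q := Suc m)"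
      have um: "u c \<le> m" if "c \<in> {1..q}" for c using u that by auto
      have sq: "?s \<in> {1..Suc m} \<rightarrow>\<^sub>E {..q}"
        using s t by (simp only: PiE_Suc_iff) (simp add: PiE_Suc_undefined)
      then have "?s \<in> {1..Suc m} \<rightarrow>\<^sub>E {..Suc q}" using PiE_mono_right by (metis le_SucI order_refl)
      moreover have "?u \<in> {1..Suc q} \<rightarrow>\<^sub>E {..Suc m}"
        using PiE_mono_right[OF u, of "Suc m"] by (simp only: PiE_Suc_iff) (simp add: PiE_Suc_undefined)
      moreover have "?s a < c" if "a \<in> {1..Suc m}" "c \<in> {1..Suc q}" "a \<le> ?u c" for a c
      proof (cases "c = Suc q")
        case True
        then show ?thesis using PiE_mem[OF sq that(1)] by simp
      next
        case False
        then have "c \<in> {1..q}" "a \<le> u c" "a \<in> {1..m}" using that um[of c] by auto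
        then show ?thesis using su by auto
      qed
      moreover have "\<not> (\<exists>c\<in>{1..q}. ?u c = Suc m)" using um by fastforce
      ultimately show "(?s, ?u) \<in> ?F - ?A" unfolding bars_def full_bars_def by auto
    qed
    show "(\<lambda>(s, u). (s (Suc m), s(Suc m := undefined), u(Suc q := undefined))) ` (?F - ?A)
        \<subseteq> {..q} \<times> bars m q"
    proof (rule image_subsetI, simp only: split_paired_all prod.case)
      fix s u assume "(s, u) \<in> ?F - ?A"
      then have F: "(s, u) \<in> ?F" and no: "\<forall>c\<in>{1..q}. u c \<noteq> Suc m" by blast+
      from F have s: "s \<in> {1..Suc m} \<rightarrow>\<^sub>E {..Suc q}" and u: "u \<in> {1..Suc q} \<rightarrow>\<^sub>E {..Suc m}"
        and su: "\<forall>a\<in>{1..Suc m}. \<forall>c\<in>{1..Suc q}. a \<le> u c \<longrightarrow> s a < c"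
        and "\<exists>c\<in>{1..Suc q}. u c = Suc m"
        by (auto simp: bars_def full_bars_def)
      with no have "u (Suc q) = Suc m" by (auto simp: le_Suc_eq)
      then have "s a \<le> q" if "a \<in> {1..Suc m}" for a using su[rule_format, of a "Suc q"] that by auto
      then have "s \<in> {1..Suc m} \<rightarrow>\<^sub>E {..q}" using s by (auto simp: PiE_iff)
      then have "s (Suc m) \<in> {..q}" "s(Suc m := undefined) \<in> {1..m} \<rightarrow>\<^sub>E {..q}"
        by (simp_all only: PiE_Suc_iff)
      moreover have "u(Suc q := undefined) \<in> {1..q} \<rightarrow>\<^sub>E {..m}"
        using u[unfolded PiE_Suc_iff] no by (fastforce simp: PiE_iff le_Suc_eq)
      ultimately show "(s (Suc m), s(Suc m := undefined), u(Suc q := undefined)) \<in> {..q} \<times> bars m q"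
        using su by (auto simp: bars_def)
    qed
  qed
  \<comment> \<open>The full last column stops every horizontal bar at length \<open>q\<close>,
    which leaves \<open>q + 1\<close> lengths for the last row.\<close>
  then have B: "card (?F - ?A) = Suc q * card (bars m q)"
    using bij_betw_same_card by (fastforce simp: card_cartesian_product)
  have "?F \<subseteq> bars (Suc m) (Suc q)" by (auto simp: full_bars_def)
  then have "finite ?F" using finite_bars by (rule finite_subset)
  have sub: "?A \<subseteq> ?F" by blast
  then have "finite ?A" using \<open>finite ?F\<close> by (rule finite_subset)
  then have "card (?F - ?A) = card ?F - card ?A" using sub by (rule card_Diff_subset)
  moreover have "card ?A \<le> card ?F" using \<open>finite ?F\<close> sub by (rule card_mono)
  ultimately have "card ?F = card ?A + card (?F - ?A)" by linarith
  then show ?thesis using A B by simp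
qed

text \<open>\<open>split\<close> at \<open>Suc q\<close> introduces the full families, and
  \<open>split\<close> at \<open>q\<close> eliminates them again after
  \<open>card_full_bars_Suc\<close>. The coefficient of \<open>card (bars m q)\<close> becomes
  \<open>(q + 1) - (m + 2) * (q + 1) = - (m + 1) * (q + 1)\<close>, the negative term in the
  recurrence of \<open>f\<close>.\<close>

lemma card_bars: "int (card (bars m q)) = f (Suc m) (Suc q)"
proof (induction m arbitrary: q)
  case 0
  then show ?case unfolding card_bars_0_left by (simp add: f.simps)
next
  case (Suc m)
  note outer = Suc.IH
  have split: "card (bars (Suc m) q) = Suc q * card (bars m q) + card (full_bars (Suc m) q)" for q
  proof -
    have "full_bars (Suc m) q \<subseteq> bars (Suc m) q" by (auto simp: full_bars_def)
    then have "card (bars (Suc m) q) = card (bars (Suc m) q - full_bars (Suc m) q) + card (full_bars (Suc m) q)"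
      using finite_bars by (metis card_Diff_subset card_mono finite_subset le_add_diff_inverse2)
    then show ?thesis by (simp add: card_bars_not_full)
  qed
  show ?case
  proof (induction q)
    case 0
    then show ?case unfolding card_bars_0_right by (simp add: f.simps)
  next
    case (Suc q)
    have "f (Suc (Suc m)) (Suc (Suc q)) = int (m + 2) * f (Suc (Suc m)) (Suc q)
        + int (q + 2) * f (Suc m) (Suc (Suc q)) - int (Suc m) * int (Suc q) * f (Suc m) (Suc q)"
      by (subst f.simps) (simp add: algebra_simps)
    also have "\<dots> = int (card (bars (Suc m) (Suc q)))"
      unfolding Suc.IH[symmetric] outer[symmetric] split card_full_bars_Suc
      by (simp add: algebra_simps)
    finally show ?case by simp
  qed
qed

section \<open>Layers of spinal vectors as families of bars\<close>

text \<open>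
  The vectors whose border cells \<open>(k + 1, k)\<close> are up-arrows precisely for \<open>k \<le> m\<close>; by spinality these
  \<open>k\<close> always form an initial segment.
\<close>

definition layer :: "nat \<Rightarrow> nat \<Rightarrow> (nat \<Rightarrow> nat) set" where
  "layer n m = {d \<in> heights n. spinal n d \<and> (\<forall>k\<in>{1..<n}. d k + k < n \<longleftrightarrow> k \<le> m)}"

lemma spinal_layers: "{d \<in> heights n. spinal n d} = (\<Union>m<n. layer n m)" if "1 \<le> n"
proof -
  have "\<exists>m<n. d \<in> layer n m" if d: "d \<in> heights n" "spinal n d" for d
  proof -
    \<comment> \<open>The added \<open>0\<close> covers the vectors for which every border cell is a
      left-arrow.\<close>
    define m where "m = Max (insert 0 {k \<in> {1..<n}. d k + k < n})"
    have "m \<in> insert 0 {k \<in> {1..<n}. d k + k < n}" unfolding m_def by (intro Max_in) auto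
    then have m: "m = 0 \<or> m \<in> {1..<n} \<and> d m + m < n" by blast
    have up: "k \<le> m" if "k \<in> {1..<n}" "d k + k < n" for k
      unfolding m_def using that by (intro Max_ge) auto
    have "d k + k < n" if "k \<in> {1..<n}" "k \<le> m" for k
    proof (cases "k = m")
      case False
      then have m: "k < m" "m < n" "d m + m < n" using that m by auto
      \<comment> \<open>Spinality for \<open>k < m\<close>: as \<open>d m + k < d m + m < n\<close>,
        the conclusion fails, so \<open>d k + m < n\<close>, which is stronger than the
        claim.\<close>
      then have "n \<le> d k + m \<longrightarrow> n \<le> d m + k" using d(2) that unfolding spinal_def by auto
      then show ?thesis using m by linarith
    qed (use that m in auto)
    with up have "d \<in> layer n m" using d unfolding layer_def by blast
    moreover have "m < n" using m \<open>1 \<le> n\<close> by auto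
    ultimately show ?thesis by blast
  qed
  then show ?thesis by (auto simp: layer_def)
qed

lemma layer_disjoint:
  assumes "m < n" "m' < n" "m \<noteq> m'"
  shows "layer n m \<inter> layer n m' = {}"
proof -
  have "layer n a \<inter> layer n b = {}" if "a < b" "b < n" for a b
    using that by (fastforce simp: layer_def dest: bspec[of _ _ b])
  then show ?thesis using assms by (metis inf_commute linorder_neqE_nat)
qed

text \<open>Comparison with index \<open>m\<close> improves the bound \<open>d k + k < n\<close> of
  the layer to \<open>d k + m < n\<close>, so that the horizontal bar \<open>k\<close> fits into
  \<open>q\<close> columns.\<close>

lemma layer_low: "d k \<le> q"
  if "d \<in> layer (Suc (m + q)) m" "1 \<le> k" "k \<le> m"
proof -
  have d: "spinal (Suc (m + q)) d" "d m + m < Suc (m + q)"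
    using that by (auto simp: layer_def dest: bspec[of _ _ m])
  show ?thesis
  proof (cases "k = m")
    case False
    then have "Suc (m + q) \<le> d k + m \<Longrightarrow> Suc (m + q) \<le> d m + k"
      using d(1)[unfolded spinal_def, rule_format, of k m] that by simp
    then show ?thesis using d that by linarith
  qed (use d in auto)
qed

text \<open>Comparison with index \<open>m + 1\<close>, whose border cell is a left-arrow; the
  deficit \<open>m + q - d k\<close> is then at most \<open>m\<close>, the height of the
  rectangle.\<close>

lemma layer_high: "q \<le> d k"
  if "d \<in> layer (Suc (m + q)) m" "m < k" "k \<le> m + q"
proof -
  have d: "spinal (Suc (m + q)) d" "Suc (m + q) \<le> d (Suc m) + Suc m"
    using that by (auto simp: layer_def not_less dest: bspec[of _ _ "Suc m"])
  show ?thesis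
  proof (cases "k = Suc m")
    case False
    then have "Suc (m + q) \<le> d (Suc m) + k \<Longrightarrow> Suc (m + q) \<le> d k + Suc m"
      using d(1)[unfolded spinal_def, rule_format, of "Suc m" k] that by simp
    then show ?thesis using d that by linarith
  qed (use d in auto)
qed

text \<open>Take \<open>s k = d k\<close> for \<open>k \<le> m\<close> and, reading the other
  indices backwards, let \<open>u c\<close> be the deficit of \<open>d j\<close> from the maximum
  \<open>m + q\<close>, where \<open>j = ?n - c\<close>. For \<open>k \<le> m < j\<close>, the
  premise \<open>?n \<le> d k + j\<close> becomes \<open>c \<le> s k\<close> and the conclusion
  \<open>?n \<le> d j + k\<close> becomes \<open>u c < k\<close>, so spinality says that the two
  bars do not meet. For indices on the same side of \<open>m\<close> it is automatic: the premise
  fails if both are at most \<open>m\<close>, and the conclusion holds if both exceed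
  \<open>m\<close>.\<close>

lemma card_layer: "card (layer (Suc (m + q)) m) = card (bars m q)"
proof -
  let ?n = "Suc (m + q)"
  let ?f = "\<lambda>(s, u). \<lambda>k\<in>{1..<?n}. if k \<le> m then s k else m + q - u (?n - k)"
  let ?g = "\<lambda>d. (\<lambda>k\<in>{1..m}. d k, \<lambda>c\<in>{1..q}. m + q - d (?n - c))"
  have "bij_betw ?f (bars m q) (layer ?n m)"
  proof (rule bij_betw_byWitness[where f' = ?g])
    show "\<forall>x\<in>bars m q. ?g (?f x) = x"
    proof
      fix x assume x: "x \<in> bars m q"
      obtain s u where su: "x = (s, u)" by force
      then have s: "s \<in> {1..m} \<rightarrow>\<^sub>E {..q}" and u: "u \<in> {1..q} \<rightarrow>\<^sub>E {..m}" using x by (auto simp: bars_def)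
      have um: "u c \<le> m" if "c \<in> {1..q}" for c using u that by auto
      have "(\<lambda>k\<in>{1..m}. ?f (s, u) k) = s"
        using s by (auto simp: fun_eq_iff PiE_def extensional_def)
      moreover have "(\<lambda>c\<in>{1..q}. m + q - ?f (s, u) (?n - c)) c = u c" for c
        using u um[of c] by (auto simp: PiE_def extensional_def)
      ultimately show "?g (?f x) = x" unfolding su by auto
    qed
    show "\<forall>d\<in>layer ?n m. ?f (?g d) = d"
    proof
      fix d assume d: "d \<in> layer ?n m"
      then have h: "d \<in> heights ?n" by (simp add: layer_def)
      have "?f (?g d) k = d k" for k
      proof (cases "k \<in> {1..<?n}")
        case True
        then have "d k \<le> m + q" using heights_less[OF h, of k] by simp
        then show ?thesis using True by (cases "k \<le> m") auto
      next
        case False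
        have "d k = undefined" using h False unfolding heights_def by (rule PiE_arb)
        then show ?thesis using False by auto
      qed
      then show "?f (?g d) = d" by (rule ext)
    qed
    show "?f ` bars m q \<subseteq> layer ?n m"
    proof (rule image_subsetI)
      fix x assume x: "x \<in> bars m q"
      obtain s u where xsu: "x = (s, u)" by force
      with x have su: "(s, u) \<in> bars m q" by simp
      then have sP: "s \<in> {1..m} \<rightarrow>\<^sub>E {..q}" and uP: "u \<in> {1..q} \<rightarrow>\<^sub>E {..m}"
        and disj: "\<And>a c. a \<in> {1..m} \<Longrightarrow> c \<in> {1..q} \<Longrightarrow> a \<le> u c \<Longrightarrow> s a < c"
        by (simp_all add: bars_def)
      have s: "s k \<le> q" if "1 \<le> k" "k \<le> m" for k using PiE_mem[OF sP, of k] that by simp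
      have u: "u c \<le> m" if "1 \<le> c" "c \<le> q" for c using PiE_mem[OF uP, of c] that by simp
      define d where "d = ?f (s, u)"
      have low: "d k = s k" if "1 \<le> k" "k \<le> m" for k using that by (simp add: d_def)
      have high: "d k + u (?n - k) = m + q" if "m < k" "k < ?n" for k
      proof -
        have "u (?n - k) \<le> m" using that by (intro u) auto
        then show ?thesis using that by (simp add: d_def)
      qed
      have "d \<in> heights ?n"
        unfolding heights_def
      proof (rule PiE_I)
        fix k assume k: "k \<in> {1..<?n}"
        show "d k \<in> {..<?n}"
          using k s[of k] low[of k] high[of k] by (cases "k \<le> m") auto
      qed (unfold d_def prod.case restrict_apply, simp only: if_False)
      moreover have "d k + k < ?n \<longleftrightarrow> k \<le> m" if "k \<in> {1..<?n}" for k
      proof (cases "k \<le> m")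
        case True
        then have "d k \<le> q" using that low s by auto
        then show ?thesis using True by simp
      next
        case False
        then have "u (?n - k) \<le> m" "d k + u (?n - k) = m + q"
          using that by (auto intro: u high)
        then show ?thesis using False by simp
      qed
      moreover have "spinal ?n d"
        unfolding spinal_def
      proof (intro allI impI)
        fix k j assume kj: "1 \<le> k" "k < j" "j < ?n" "?n \<le> d k + j"
        consider "j \<le> m" | "k \<le> m" "m < j" | "m < k" by linarith
        then show "?n \<le> d j + k"
        proof cases
          case 1
          then show ?thesis using kj low[of k] s[of k] by auto
        next
          case 2
          \<comment> \<open>The horizontal bar \<open>k\<close> covers column \<open>?n - j\<close>,
            so the vertical bar there ends above row \<open>k\<close>.\<close>
          then have "?n - j \<le> s k" using kj low[of k] by auto
          moreover have "k \<in> {1..m}" "?n - j \<in> {1..q}" using kj 2 by auto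
          ultimately have "u (?n - j) < k" using disj[of k "?n - j"] by linarith
          moreover have "d j + u (?n - j) = m + q" using kj 2 high by auto
          ultimately show ?thesis by linarith
        next
          case 3
          then have "d j + u (?n - j) = m + q" "u (?n - j) \<le> m" using kj high u by auto
          then show ?thesis using 3 by linarith
        qed
      qed
      ultimately have "d \<in> layer ?n m" unfolding layer_def by blast
      then show "?f x \<in> layer ?n m" unfolding d_def xsu .
    qed
    show "?g ` layer ?n m \<subseteq> bars m q"
    proof (rule image_subsetI)
      fix d assume d: "d \<in> layer ?n m"
      have "d a < c" if a: "a \<in> {1..m}" and c: "c \<in> {1..q}" and le: "a \<le> m + q - d (?n - c)" for a c
      proof -
        have "?n \<le> d a + (?n - c) \<longrightarrow> ?n \<le> d (?n - c) + a"
          using d a c by (auto simp: layer_def spinal_def)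
        then show ?thesis using a c le by auto
      qed
      moreover have "m + q - d (?n - c) \<le> m" if "c \<in> {1..q}" for c
      proof -
        have "q \<le> d (?n - c)" using that by (intro layer_high[OF d]) auto
        then show ?thesis by simp
      qed
      ultimately show "?g d \<in> bars m q"
        unfolding bars_def using layer_low[OF d] by auto
    qed
  qed
  then show ?thesis using bij_betw_same_card by fastforce
qed

lemma card_spinal:
  assumes "1 \<le> n"
  shows "int (card {d \<in> heights n. spinal n d}) =
    (\<Sum>(i, j) \<in> {(i, j). 1 \<le> i \<and> 1 \<le> j \<and> i + j = n + 1}. f i j)"
proof -
  have "card {d \<in> heights n. spinal n d} = (\<Sum>m<n. card (layer n m))"
    unfolding spinal_layers[OF assms]
    by (rule card_UN_disjoint) (use finite_heights[of n] layer_disjoint in \<open>auto simp: layer_def\<close>)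
  also have "\<dots> = (\<Sum>m<n. card (bars m (n - 1 - m)))"
    
  proof (rule sum.cong)
    fix m assume "m \<in> {..<n}"
    then show "card (layer n m) = card (bars m (n - 1 - m))" using card_layer[of m "n - 1 - m"] by simp
  qed simp
  \<comment> \<open>The second index is \<open>Suc (n - 1 - m)\<close>, which equals
    \<open>n - m\<close> because \<open>m < n\<close>.\<close>
  finally have "int (card {d \<in> heights n. spinal n d}) = (\<Sum>m<n. f (Suc m) (n - m))"
    by (auto simp: card_bars Suc_diff_Suc intro!: sum.cong)
  also have "\<dots> = (\<Sum>(i, j) \<in> {(i, j). 1 \<le> i \<and> 1 \<le> j \<and> i + j = n + 1}. f i j)"
    by (rule sum.reindex_bij_witness[of _ "\<lambda>(i, j). i - 1" "\<lambda>m. (Suc m, n - m)"]) auto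
  finally show ?thesis .
qed

theorem proposition10p7:
  fixes n :: nat
  assumes "n \<ge> 1"
  shows "int (card (spine n)) =
    (\<Sum>(i, j) \<in> {(i, j). 1 \<le> i \<and> 1 \<le> j \<and> i + j = n + 1}. f i j)"
proof -
  have "{d \<in> heights n. spinal n d} \<subseteq> {d \<in> heights n. admissible n d}"
    using spinal_imp_admissible by blast
  then have "card (spine n) = card {d \<in> heights n. spinal n d}"
    unfolding spine_eq[OF assms]
    using card_image inj_on_subset[OF inj_on_tableau[OF assms]] by blast
  then show ?thesis using card_spinal[OF assms] by simp
qed

end
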